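(* Let $\mathcal A=\mathbb Z/2=\{0,1\}$ and let $\Phi:\mathcal A^{\mathbb Z}\to\mathcal A^{\mathbb Z}$ be the cellular automaton $\Phi(\mathbf a)_\ell=a_\ell+a_{\ell+1}\pmod 2$. If $\mathcal P\in\Phi_\varsigma(\mathcal M)$, then $\overline{\mathcal P}\notin\Phi_\varsigma(\mathcal M)$.
   Context: Fix an integer $K\ge1$, $\mathbf{T}=(\mathbb{R}/\mathbb{Z})^K$ with Lebesgue (Haar) probability measure $\lambda$, and $\alpha\in\mathbf T$ such that $z\mapsto z\alpha$ is an injective homomorphism $\mathbb Z\to\mathbf T$ with dense image. Let $\varsigma^z(t)=t+z\alpha$ for $z\in\mathbb Z$. $\mathcal M$ is the set of $\{0,1\}$-labelled measurable partitions $\mathcal P=\{P_0,P_1\}$ of $\mathbf T$: $P_0,P_1$ disjoint measurable with $\lambda(P_0\sqcup P_1)=1$; partitions that agree up to $\lambda$-null sets are identified. The map induced by $\Phi$ is $\Phi_\varsigma(\mathcal P)=\{Q_0,Q_1\}$ where $Q_a=\bigcup_{c_0,c_1\in\{0,1\},\ c_0+c_1\equiv a\ (2)}P_{c_0}\cap\varsigma^{-1}(P_{c_1})$ (so, up to null sets, $Q_1=P_1\triangle\varsigma^{-1}(P_1)$ and $Q_0$ is its complement). For $\mathcal P=\{P_0,P_1\}$, $\overline{\mathcal P}=\{\overline P_0,\overline P_1\}$ is defined by $\overline P_0:=P_1$, $\overline P_1:=P_0$. *)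

theory Defs
  imports "HOL-Analysis.Analysis" "HOL-Library.Z2"
begin

section \<open>The circle group\<close>

quotient_type circle = real / "\<lambda>x y :: real. x - y \<in> \<int>"
  morphisms rep_circle to_circle
proof (rule equivpI)
  show "reflp (\<lambda>x y :: real. x - y \<in> \<int>)"
    by (simp add: reflp_def)
  show "symp (\<lambda>x y :: real. x - y \<in> \<int>)"
  proof (rule sympI)
    fix x y :: real
    assume "x - y \<in> \<int>"
    then have "- (x - y) \<in> \<int>" by (rule Ints_minus)
    then show "y - x \<in> \<int>" by simp
  qed
  show "transp (\<lambda>x y :: real. x - y \<in> \<int>)"
  proof (rule transpI)
    fix x y z :: real
    assume "x - y \<in> \<int>" "y - z \<in> \<int>"
    then have "(x - y) + (y - z) \<in> \<int>" by (rule Ints_add)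
    then show "x - z \<in> \<int>" by simp
  qed
qed

instantiation circle :: ab_group_add
begin

lift_definition zero_circle :: circle is "0 :: real" .

lift_definition plus_circle :: "circle \<Rightarrow> circle \<Rightarrow> circle" is "(+) :: real \<Rightarrow> real \<Rightarrow> real"
proof -
  fix a b c d :: real
  assume "a - b \<in> \<int>" "c - d \<in> \<int>"
  then have "(a - b) + (c - d) \<in> \<int>" by (rule Ints_add)
  then show "a + c - (b + d) \<in> \<int>" by (simp add: algebra_simps)
qed

lift_definition minus_circle :: "circle \<Rightarrow> circle \<Rightarrow> circle" is "(-) :: real \<Rightarrow> real \<Rightarrow> real"
proof -
  fix a b c d :: real
  assume "a - b \<in> \<int>" "c - d \<in> \<int>"
  then have "(a - b) - (c - d) \<in> \<int>" by (rule Ints_diff)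
  then show "a - c - (b - d) \<in> \<int>" by (simp add: algebra_simps)
qed

lift_definition uminus_circle :: "circle \<Rightarrow> circle" is "uminus :: real \<Rightarrow> real"
proof -
  fix a b :: real
  assume "a - b \<in> \<int>"
  then have "- (a - b) \<in> \<int>" by (rule Ints_minus)
  then show "- a - - b \<in> \<int>" by simp
qed

instance
proof
  fix a b c :: circle
  show "a + b + c = a + (b + c)" by transfer simp
  show "a + b = b + a" by transfer simp
  show "0 + a = a" by transfer simp
  show "- a + a = 0" by transfer simp
  show "a - b = a + - b" by transfer simp
qed

end

instantiation circle :: topological_space
begin

text \<open>The quotient topology.\<close>

definition open_circle :: "circle set \<Rightarrow> bool"
  where "open_circle U \<longleftrightarrow> open (to_circle -` U)"

instance
proof
  show "open (UNIV :: circle set)"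
    by (simp add: open_circle_def)
  show "open (S \<inter> T)" if "open S" "open T" for S T :: "circle set"
    using that by (simp add: open_circle_def open_Int)
  show "open (\<Union>K)" if "\<forall>S\<in>K. open S" for K :: "circle set set"
    using that by (simp add: open_circle_def vimage_Union open_UN)
qed

end

lemma continuous_on_to_circle: "continuous_on UNIV to_circle"
  by (simp add: continuous_on_open_vimage open_circle_def)


section \<open>The torus and its rotations\<close>

text \<open>
  The \<open>K\<close>-dimensional torus is the type \<open>circle ^ 'k\<close> with \<open>CARD('k) = K\<close>; its group
  structure and product topology are the library's for finite Cartesian powers.
\<close>

definition to_torus :: "real ^ 'k \<Rightarrow> circle ^ 'k::finite"
  where "to_torus x = (\<chi> i. to_circle (x $ i))"

definition unit_cube :: "(real ^ 'k::finite) set"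
  where "unit_cube = {x. \<forall>i. 0 \<le> x $ i \<and> x $ i < 1}"

text \<open>
  Lebesgue measure on the torus: the image of Lebesgue measure on the fundamental domain
  \<open>[0,1)\<^sup>K\<close>, completed, so that ``measurable'' means Lebesgue measurable.
\<close>

definition torus_measure :: "(circle ^ 'k::finite) measure"
  where "torus_measure = completion (distr (restrict_space lborel unit_cube) borel to_torus)"

lemma continuous_on_to_torus: "continuous_on UNIV (to_torus :: real ^ 'k \<Rightarrow> circle ^ 'k::finite)"
  unfolding to_torus_def
proof (rule continuous_on_vec_lambda)
  show "continuous_on UNIV (\<lambda>x :: real ^ 'k. to_circle (x $ i))" for i
    by (rule continuous_on_compose2[OF continuous_on_to_circle])
      (simp_all add: continuous_on_component)
qed

lemma unit_cube_borel [measurable]: "unit_cube \<in> sets borel"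
  unfolding unit_cube_def by measurable

lemma to_torus_measurable [measurable]: "to_torus \<in> restrict_space lborel unit_cube \<rightarrow>\<^sub>M borel"
  by (intro measurable_restrict_space1)
    (simp add: borel_measurable_continuous_onI continuous_on_to_torus)

lemma emeasure_unit_cube: "emeasure lborel (unit_cube :: (real ^ 'k::finite) set) = 1"
proof (rule antisym)
  have 1: "(1 - 0 :: real ^ 'k) \<bullet> b = 1" if "b \<in> Basis" for b
    using that by (auto simp: Basis_vec_def inner_axis)
  have le: "\<forall>b\<in>Basis. (0 :: real ^ 'k) \<bullet> b \<le> 1 \<bullet> b"
    using 1 by simp
  have "emeasure lborel (unit_cube :: (real ^ 'k) set) \<le> emeasure lborel (cbox 0 (1 :: real ^ 'k))"
    by (intro emeasure_mono) (auto simp: unit_cube_def mem_box_cart less_imp_le)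
  also have "\<dots> = 1"
    using 1 le by (simp add: emeasure_lborel_cbox_eq)
  finally show "emeasure lborel (unit_cube :: (real ^ 'k) set) \<le> 1" .
  have "1 = emeasure lborel (box 0 (1 :: real ^ 'k))"
    using 1 le by (simp add: emeasure_lborel_box_eq)
  also have "\<dots> \<le> emeasure lborel (unit_cube :: (real ^ 'k) set)"
    by (intro emeasure_mono) (auto simp: unit_cube_def mem_box_cart less_imp_le)
  finally show "1 \<le> emeasure lborel (unit_cube :: (real ^ 'k) set)" .
qed

lemma emeasure_torus_UNIV: "emeasure torus_measure (UNIV :: (circle ^ 'k::finite) set) = 1"
proof -
  have "emeasure torus_measure (UNIV :: (circle ^ 'k) set) =
      emeasure (restrict_space lborel unit_cube) (to_torus -` (UNIV :: (circle ^ 'k) set) \<inter> unit_cube)"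
    by (simp add: torus_measure_def emeasure_distr space_restrict_space)
  also have "\<dots> = 1"
    by (simp add: emeasure_restrict_space emeasure_unit_cube)
  finally show ?thesis .
qed

lemma space_torus_measure [simp]: "space torus_measure = UNIV"
  by (simp add: torus_measure_def)

text \<open>The integer multiple \<open>z a\<close> in an additive group.\<close>

definition int_mult :: "int \<Rightarrow> 'a::ab_group_add \<Rightarrow> 'a"
  where "int_mult z a = (if 0 \<le> z then (\<Sum>_<nat z. a) else - (\<Sum>_<nat (- z). a))"

definition rotation :: "circle ^ 'k::finite \<Rightarrow> int \<Rightarrow> circle ^ 'k \<Rightarrow> circle ^ 'k"
  where "rotation \<alpha> z t = t + int_mult z \<alpha>"


section \<open>Labelled partitions modulo null sets\<close>

definition labelled_partitions :: "(bit \<Rightarrow> (circle ^ 'k::finite) set) set"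
  where "labelled_partitions =
    {P. (\<forall>a. P a \<in> sets torus_measure) \<and> P 0 \<inter> P 1 = {} \<and> measure torus_measure (P 0 \<union> P 1) = 1}"

definition ae_equal :: "((bit \<Rightarrow> (circle ^ 'k::finite) set) \<times> (bit \<Rightarrow> (circle ^ 'k) set)) set"
  where "ae_equal = {(P, Q). P \<in> labelled_partitions \<and> Q \<in> labelled_partitions \<and>
    (\<forall>a. (P a - Q a) \<union> (Q a - P a) \<in> null_sets torus_measure)}"

definition partition_space :: "(bit \<Rightarrow> (circle ^ 'k::finite) set) set set"
  where "partition_space = labelled_partitions // ae_equal"

definition swap_labels :: "(bit \<Rightarrow> 'a set) \<Rightarrow> bit \<Rightarrow> 'a set"
  where "swap_labels P a = P (a + 1)"

definition swap_class ::
    "(bit \<Rightarrow> (circle ^ 'k::finite) set) set \<Rightarrow> (bit \<Rightarrow> (circle ^ 'k) set) set"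
  where "swap_class \<P> = (\<Union>P\<in>\<P>. ae_equal `` {swap_labels P})"


section \<open>The cellular automaton and its action on partitions\<close>

definition ledrappier :: "(int \<Rightarrow> bit) \<Rightarrow> int \<Rightarrow> bit"
  where "ledrappier a l = a l + a (l + 1)"

text \<open>
  For a cellular automaton \<open>\<Phi>\<close> with neighbourhood \<open>{0, 1}\<close>, the union runs over the words
  \<open>c\<^sub>0 c\<^sub>1\<close> that the local rule of \<open>\<Phi>\<close> maps to \<open>a\<close>; for \<open>ledrappier\<close> these are the words
  with \<open>c\<^sub>0 + c\<^sub>1 = a\<close>, see below.
\<close>

definition induced ::
    "((int \<Rightarrow> bit) \<Rightarrow> int \<Rightarrow> bit) \<Rightarrow> circle ^ 'k::finite \<Rightarrow>
      (bit \<Rightarrow> (circle ^ 'k) set) \<Rightarrow> bit \<Rightarrow> (circle ^ 'k) set"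
  where "induced \<Phi> \<alpha> P a =
    (\<Union>(c0, c1) \<in> {(c0, c1). \<exists>x. x 0 = c0 \<and> x 1 = c1 \<and> \<Phi> x 0 = a}.
       P c0 \<inter> rotation \<alpha> 1 -` P c1)"

definition induced_class ::
    "((int \<Rightarrow> bit) \<Rightarrow> int \<Rightarrow> bit) \<Rightarrow> circle ^ 'k::finite \<Rightarrow>
      (bit \<Rightarrow> (circle ^ 'k) set) set \<Rightarrow> (bit \<Rightarrow> (circle ^ 'k) set) set"
  where "induced_class \<Phi> \<alpha> \<P> = (\<Union>P\<in>\<P>. ae_equal `` {induced \<Phi> \<alpha> P})"

lemma induced_ledrappier:
  "induced ledrappier \<alpha> P a =
    (\<Union>(c0, c1) \<in> {(c0, c1). c0 + c1 = a}. P c0 \<inter> rotation \<alpha> 1 -` P c1)"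
proof -
  have "(\<exists>x :: int \<Rightarrow> bit. x 0 = c0 \<and> x 1 = c1 \<and> ledrappier x 0 = a) \<longleftrightarrow> c0 + c1 = a" for c0 c1
    by (auto simp: ledrappier_def intro!: exI[of _ "\<lambda>l. if l = 0 then c0 else c1"])
  then show ?thesis
    by (simp add: induced_def)
qed

lemma int_mult_nat: "int_mult (int n) a = (\<Sum>_<n. a)"
  by (simp add: int_mult_def)

lemma int_mult_1 [simp]: "int_mult 1 a = a"
  by (simp add: int_mult_def)

lemma int_mult_Suc: "int_mult (z + 1) a = int_mult z a + a"
proof (cases "0 \<le> z")
  case True
  then show ?thesis by (simp add: int_mult_def nat_add_distrib add.commute)
next
  case False
  define n where "n = nat (- (z + 1))"
  have n: "nat (- z) = Suc n" "nat (- (z + 1)) = n" "z + 1 = - int n"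
    using False by (simp_all add: n_def)
  have "int_mult z a = - ((\<Sum>_<n. a) + a)"
    using False n by (simp add: int_mult_def add.commute)
  moreover have "int_mult (z + 1) a = - (\<Sum>_<n. a)"
    using n by (simp add: int_mult_def)
  ultimately show ?thesis
    by (simp only: minus_add_distrib add.assoc left_minus add_0_right)
qed

lemma int_mult_add: "int_mult (y + z) a = int_mult y a + int_mult z a"
proof (induction z rule: int_induct[of _ 0])
  case base
  then show ?case by (simp add: int_mult_def)
next
  case (step1 i)
  have "int_mult (y + (i + 1)) a = int_mult (y + i) a + a"
    using int_mult_Suc[of "y + i" a] by (simp add: add.assoc)
  then show ?case
    using step1.IH by (simp add: int_mult_Suc add.assoc)
next
  case (step2 i)
  have "int_mult (y + i) a = int_mult (y + (i - 1)) a + a"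
    using int_mult_Suc[of "y + (i - 1)" a] by (simp add: add.assoc)
  moreover have "int_mult i a = int_mult (i - 1) a + a"
    using int_mult_Suc[of "i - 1" a] by simp
  ultimately have "int_mult (y + (i - 1)) a + a = (int_mult y a + int_mult (i - 1) a) + a"
    using step2.IH by (simp add: add.assoc)
  then show ?case by (simp only: add_right_cancel)
qed

lemma equiv_ae_equal: "equiv labelled_partitions ae_equal"
proof (rule equivI)
  show "ae_equal \<subseteq> labelled_partitions \<times> labelled_partitions"
    by (auto simp: ae_equal_def)
  show "refl_on labelled_partitions ae_equal"
    by (auto simp: refl_on_def ae_equal_def)
  show "sym ae_equal"
    by (auto simp: sym_def ae_equal_def Un_commute)
  show "trans ae_equal"
  proof (rule transI)
    fix P Q R :: "bit \<Rightarrow> (circle ^ 'k::finite) set"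
    assume PQ: "(P, Q) \<in> ae_equal" and QR: "(Q, R) \<in> ae_equal"
    have "(P a - R a) \<union> (R a - P a) \<in> null_sets torus_measure" for a
    proof (rule null_sets_subset)
      have "(P a - Q a) \<union> (Q a - P a) \<in> null_sets torus_measure"
        using PQ unfolding ae_equal_def by blast
      moreover have "(Q a - R a) \<union> (R a - Q a) \<in> null_sets torus_measure"
        using QR unfolding ae_equal_def by blast
      ultimately show
        "((P a - Q a) \<union> (Q a - P a)) \<union> ((Q a - R a) \<union> (R a - Q a)) \<in> null_sets torus_measure"
        by (rule null_sets.Un)
      have "P a \<in> sets torus_measure" "R a \<in> sets torus_measure"
        using PQ QR unfolding ae_equal_def labelled_partitions_def by blast+
      then show "(P a - R a) \<union> (R a - P a) \<in> sets torus_measure"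
        by (intro sets.Un sets.Diff)
      show "(P a - R a) \<union> (R a - P a) \<subseteq> ((P a - Q a) \<union> (Q a - P a)) \<union> ((Q a - R a) \<union> (R a - Q a))"
        by blast
    qed
    then show "(P, R) \<in> ae_equal"
      using PQ QR unfolding ae_equal_def by blast
  qed
qed

end

theory Submission
  imports Defs
begin

text \<open>
  Suppose that the partitions \<open>R\<close> and \<open>S\<close> are mapped by \<open>ledrappier\<close> to a partition and to its
  label swap. Let \<open>d\<close> be the sum modulo 2 of the labels that \<open>R\<close> and \<open>S\<close> give to a point. The
  images of \<open>R\<close> and \<open>S\<close> have opposite labels almost everywhere and \<open>ledrappier\<close> is additive, so
  \<open>d(t) + d(t + \<alpha>) = 1\<close> for almost every \<open>t\<close>: the rotation by \<open>\<alpha>\<close> flips the measurable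
  set \<open>D = {d = 1}\<close>.

  Such a \<open>D\<close> does not exist when the multiples of \<open>\<alpha>\<close> are dense. If \<open>\<alpha>\<close> flips \<open>D\<close>, then
  \<open>z\<alpha>\<close> preserves \<open>D\<close> for even \<open>z\<close> and flips it for odd \<open>z\<close>. The torus is divisible, so
  \<open>\<alpha> = 2\<beta>\<close> for some \<open>\<beta>\<close>, and \<open>\<beta>\<close> is a limit of multiples \<open>z\<alpha>\<close>. Then \<open>\<alpha> - 2z\<alpha>\<close> is an
  odd multiple of \<open>\<alpha>\<close>, hence flips \<open>D\<close>, and can be made as close to 0 as desired. But by
  Steinhaus' theorem a set of positive measure meets all its sufficiently small translates in
  positive measure, and \<open>D\<close> or its complement has positive measure; so small translations cannot
  flip \<open>D\<close>. This is \<open>no_flip_of_dense\<close>.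

  The measure theory takes place in Euclidean space, where measurable sets are approximated by
  compact ones and where a lift of \<open>\<alpha>\<close> is halved by scaling: \<open>to_torus\<close> pulls null sets and measurable sets of the
  torus back to null sets and measurable sets, and dense sets to dense sets
  (\<open>AE_to_torus\<close>, \<open>vimage_to_torus_measurable\<close>, \<open>dense_vimage_to_torus\<close>).
  Since images are taken between classes of partitions modulo null sets, it must also be known that
  the image of a labelled partition is again one, so that its class is not empty
  (\<open>induced_labelled\<close>).
\<close>

section \<open>Translations of Euclidean space that flip a measurable set\<close>

lemma AE_lebesgue_iff_negligible:
  "(AE x in lebesgue. P x) \<longleftrightarrow> negligible {x :: 'a::euclidean_space. \<not> P x}"
proof -
  have "(AE x in lebesgue. P x) \<longleftrightarrow> {x. \<not> P x} \<in> null_sets lebesgue"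
    using completion.complete2[of _ _ lborel]
    by (auto simp: eventually_ae_filter)
  then show ?thesis
    by (simp add: negligible_iff_null_sets)
qed

lemma AE_lebesgue_translate:
  assumes "AE x :: 'a::euclidean_space in lebesgue. P x"
  shows "AE x in lebesgue. P (x + c)"
proof -
  have "{x. \<not> P (x + c)} = (+) (- c) ` {x. \<not> P x}"
    by (force simp: image_iff)
  then show ?thesis
    using assms negligible_translation[of "{x. \<not> P x}" "- c"] by (simp add: AE_lebesgue_iff_negligible)
qed

text \<open>
  Cutting \<open>D\<close> with a large ball makes the measure finite, so that inner approximation by a closed
  set can be asked to lose less than all of it.
\<close>

lemma compact_subset_not_negligible:
  fixes D :: "'a::euclidean_space set"
  assumes "D \<in> sets lebesgue" "\<not> negligible D"
  obtains C where "compact C" "C \<subseteq> D" "\<not> negligible C"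
proof -
  have "D = (\<Union>n :: nat. D \<inter> cball 0 n)"
    by (auto simp: real_arch_simple)
  then obtain n :: nat where n: "\<not> negligible (D \<inter> cball 0 n)"
    using assms(2) negligible_countable_Union[of "range (\<lambda>n :: nat. D \<inter> cball 0 n)"] by auto
  define B where "B = D \<inter> cball 0 (real n)"
  have B: "B \<in> lmeasurable"
    unfolding B_def using assms(1) by (intro bounded_set_imp_lmeasurable) auto
  have pos: "measure lebesgue B > 0"
    using n B negligible_iff_measure[of B] by (simp add: B_def[symmetric] zero_less_measure_iff)
  obtain C where C: "closed C" "C \<subseteq> B" "B - C \<in> lmeasurable"
    and less: "emeasure lebesgue (B - C) < ennreal (measure lebesgue B)"
    using sets_lebesgue_inner_closed[of B "measure lebesgue B"] B pos by (metis fmeasurableD)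
  have "compact C"
    using C unfolding B_def by (meson bounded_Int bounded_cball bounded_subset compact_eq_bounded_closed)
  moreover have "\<not> negligible C"
  proof
    assume "negligible C"
    then have "measure lebesgue (B - C) = measure lebesgue B"
      by (intro measure_negligible_symdiff[OF B]) (rule negligible_subset, auto)
    then show False
      using less C(3) by (simp add: emeasure_eq_measure2)
  qed
  ultimately show thesis
    using C that unfolding B_def by blast
qed

text \<open>
  Steinhaus' theorem. Take a compact \<open>C \<subseteq> D\<close> of positive measure and an open
  \<open>U \<supseteq> C\<close> of measure less than twice that of \<open>C\<close>. A small translate of \<open>C\<close> still lies in \<open>U\<close>,
  and \<open>U\<close> has no room for two almost disjoint copies of \<open>C\<close>.
\<close>

lemma small_translate_meets:
  fixes D :: "'a::euclidean_space set"
  assumes "D \<in> sets lebesgue" "\<not> negligible D"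
  obtains d where "d > 0" "\<And>s. norm s < d \<Longrightarrow> \<not> negligible {x \<in> D. x + s \<in> D}"
proof -
  obtain C where C: "compact C" "C \<subseteq> D" "\<not> negligible C"
    using compact_subset_not_negligible[OF assms] .
  have lC: "C \<in> lmeasurable"
    using C(1) by (simp add: lmeasurable_compact)
  have pos: "measure lebesgue C > 0"
    using C(3) lC negligible_iff_measure[of C] by (simp add: zero_less_measure_iff)
  obtain U where U: "open U" "C \<subseteq> U" "U - C \<in> lmeasurable"
    and less: "emeasure lebesgue (U - C) < ennreal (measure lebesgue C)"
    using sets_lebesgue_outer_open[of C "measure lebesgue C"] lC pos by (metis fmeasurableD)
  obtain d where d: "d > 0" "(\<Union>x\<in>C. ball x d) \<subseteq> U"
    using compact_subset_open_imp_ball_epsilon_subset[OF C(1) U(1,2)] .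
  show thesis
  proof (rule that[OF d(1)])
    fix s :: 'a
    assume s: "norm s < d"
    show "\<not> negligible {x \<in> D. x + s \<in> D}"
    proof
      assume "negligible {x \<in> D. x + s \<in> D}"
      then have "negligible ((+) s ` {x \<in> D. x + s \<in> D})"
        by (rule negligible_translation)
      then have "negligible (C \<inter> (+) s ` C)"
        by (rule negligible_subset) (use C(2) in \<open>auto simp: add.commute\<close>)
      \<comment> \<open>\<open>C + s\<close> and \<open>(C + s) - C\<close> differ by a null set, so they have the same measure.\<close>
      then have neg: "negligible ((+) s ` C - ((+) s ` C - C) \<union> (((+) s ` C - C) - (+) s ` C))"
        by (rule negligible_subset) auto
      have "measure lebesgue C = measure lebesgue ((+) s ` C)"
        by (simp add: measure_translation)
      also have "\<dots> = measure lebesgue ((+) s ` C - C)"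
        using measure_negligible_symdiff[OF _ neg] lC by (simp add: measurable_translation)
      also have "\<dots> \<le> measure lebesgue (U - C)"
      proof (rule measure_mono_fmeasurable[OF _ _ U(3)])
        show "(+) s ` C - C \<subseteq> U - C"
          using d(2) s by (force simp: dist_norm)
        show "(+) s ` C - C \<in> sets lebesgue"
          using lC by (simp add: measurable_translation fmeasurableD sets.Diff)
      qed
      also have "\<dots> < measure lebesgue C"
        using less U(3) by (simp add: emeasure_eq_measure2 ennreal_less_iff)
      finally show False by simp
    qed
  qed
qed

lemma small_translate_no_flip:
  fixes D :: "'a::euclidean_space set"
  assumes "D \<in> sets lebesgue"
  obtains d where "d > 0" "\<And>s. norm s < d \<Longrightarrow> \<not> (AE x in lebesgue. x + s \<in> D \<longleftrightarrow> x \<notin> D)"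
proof -
  have "\<exists>E\<in>{D, - D}. \<not> negligible E"
    using negligible_Un[of D "- D"] by auto
  then obtain E where E: "E \<in> {D, - D}" "\<not> negligible E"
    by blast
  have "E \<in> sets lebesgue"
    using E(1) assms by (auto simp: Compl_in_sets_lebesgue)
  then obtain d where d: "d > 0" "\<And>s. norm s < d \<Longrightarrow> \<not> negligible {x \<in> E. x + s \<in> E}"
    using small_translate_meets E(2) by metis
  show thesis
  proof (rule that[OF d(1)])
    fix s :: 'a
    assume "norm s < d"
    then have "\<not> negligible {x \<in> E. x + s \<in> E}"
      by (rule d)
    moreover have "{x \<in> E. x + s \<in> E} \<subseteq> {x. \<not> (x + s \<in> D \<longleftrightarrow> x \<notin> D)}"
      using E(1) by auto
    ultimately show "\<not> (AE x in lebesgue. x + s \<in> D \<longleftrightarrow> x \<notin> D)"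
      unfolding AE_lebesgue_iff_negligible using negligible_subset by blast
  qed
qed

text \<open>
  Each translation in \<open>L\<close> preserves \<open>D\<close> (\<open>e = True\<close>) or flips it (\<open>e = False\<close>). In either case
  translating by \<open>2l\<close> preserves \<open>D\<close>, so \<open>a - 2l\<close> flips \<open>D\<close> as soon as \<open>a\<close> does; and \<open>a - 2l\<close> is
  small when \<open>l\<close> approximates \<open>a/2\<close>.
\<close>

lemma no_flip_of_dense:
  fixes D L :: "'a::euclidean_space set"
  assumes D: "D \<in> sets lebesgue"
    and dense: "closure L = UNIV"
    and L: "\<And>l. l \<in> L \<Longrightarrow> \<exists>e. AE x in lebesgue. x + l \<in> D \<longleftrightarrow> (x \<in> D \<longleftrightarrow> e)"
  shows "\<not> (AE x in lebesgue. x + a \<in> D \<longleftrightarrow> x \<notin> D)"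
proof
  assume flip: "AE x in lebesgue. x + a \<in> D \<longleftrightarrow> x \<notin> D"
  obtain d where d: "d > 0" "\<And>s. norm s < d \<Longrightarrow> \<not> (AE x in lebesgue. x + s \<in> D \<longleftrightarrow> x \<notin> D)"
    using small_translate_no_flip[OF D] by blast
  have "(1/2) *\<^sub>R a \<in> closure L"
    by (simp add: dense)
  then obtain l where l: "l \<in> L" "dist l ((1/2) *\<^sub>R a) < d / 2"
    using d(1) unfolding closure_approachable by (metis half_gt_zero)
  define s where "s = a - 2 *\<^sub>R l"
  have "s = 2 *\<^sub>R ((1/2) *\<^sub>R a - l)"
    by (simp add: s_def scaleR_diff_right)
  then have "norm s = 2 * dist l ((1/2) *\<^sub>R a)"
    by (metis abs_numeral dist_commute dist_norm norm_scaleR)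
  then have "norm s < d"
    using l(2) by simp
  obtain e where e: "AE x in lebesgue. x + l \<in> D \<longleftrightarrow> (x \<in> D \<longleftrightarrow> e)"
    using L[OF l(1)] by blast
  have "AE x in lebesgue. x + s \<in> D \<longleftrightarrow> x \<notin> D"
    using AE_lebesgue_translate[OF e, of s] AE_lebesgue_translate[OF e, of "s + l"] flip
  proof eventually_elim
    case (elim x)
    have "x + (s + l) + l = x + a"
      by (simp add: s_def scaleR_2)
    then show ?case
      using elim by (simp only: add.assoc[symmetric]) blast
  qed
  then show False
    using d(2) \<open>norm s < d\<close> by blast
qed

section \<open>The torus as a quotient of Euclidean space\<close>

lemma to_circle_add: "to_circle (x + y) = to_circle x + to_circle y"
  by (simp add: plus_circle.abs_eq)

lemma to_circle_eq_iff: "to_circle x = to_circle y \<longleftrightarrow> x - y \<in> \<int>"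
  by (rule circle.abs_eq_iff)

lemma to_torus_add: "to_torus (x + y) = to_torus x + to_torus y"
  by (simp add: to_torus_def to_circle_add vec_eq_iff)

lemma surj_to_torus: "surj to_torus"
proof (rule surjI)
  show "to_torus (\<chi> i. rep_circle (t $ i)) = t" for t :: "circle ^ 'k"
    by (simp add: to_torus_def vec_eq_iff Quotient3_abs_rep[OF Quotient3_circle])
qed

lemma open_map_to_circle:
  assumes "open U"
  shows "open (to_circle ` U)"
proof -
  have "to_circle -` (to_circle ` U) = (\<Union>n :: int. (+) (of_int n) ` U)"
  proof (intro equalityI subsetI)
    fix x
    assume "x \<in> to_circle -` (to_circle ` U)"
    then obtain y where "y \<in> U" "x - y \<in> \<int>"
      by (auto simp: to_circle_eq_iff)
    then show "x \<in> (\<Union>n :: int. (+) (of_int n) ` U)"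
      by (auto elim!: Ints_cases simp: algebra_simps image_iff intro!: bexI[of _ y])
  next
    fix x
    assume "x \<in> (\<Union>n :: int. (+) (of_int n) ` U)"
    then obtain n :: int and y where "x = of_int n + y" "y \<in> U"
      by auto
    then have "to_circle x = to_circle y"
      by (simp add: to_circle_eq_iff)
    then show "x \<in> to_circle -` (to_circle ` U)"
      using \<open>y \<in> U\<close> by simp
  qed
  then show ?thesis
    using assms by (simp add: open_circle_def open_UN open_translation)
qed

text \<open>
  Preimages of dense sets under an open map are dense. The small open neighbourhoods used here are
  the images of products of balls, because the topology of the torus is that of a finite power.
\<close>

lemma dense_vimage_to_torus:
  fixes S :: "(circle ^ 'k::finite) set"
  assumes "closure S = UNIV"
  shows "closure (to_torus -` S) = UNIV"
proof -
  have "\<exists>y\<in>to_torus -` S. dist y x < e" if "e > 0" for x :: "real ^ 'k" and e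
  proof -
    define d where "d = e / CARD('k)"
    have d: "d > 0"
      using that by (simp add: d_def)
    define V where "V = {t :: circle ^ 'k. \<forall>i. t $ i \<in> to_circle ` ball (x $ i) d}"
    have "open V"
      unfolding open_vec_def
    proof
      fix t
      assume "t \<in> V"
      then show "\<exists>A. (\<forall>i. open (A i) \<and> t $ i \<in> A i) \<and> (\<forall>u. (\<forall>i. u $ i \<in> A i) \<longrightarrow> u \<in> V)"
        by (intro exI[of _ "\<lambda>i. to_circle ` ball (x $ i) d"]) (auto simp: V_def open_map_to_circle)
    qed
    moreover have "to_torus x \<in> V"
      using d by (auto simp: V_def to_torus_def)
    ultimately obtain t where t: "t \<in> S" "t \<in> V"
      using assms open_Int_closure_eq_empty[of V S] by auto
    have "\<forall>i. \<exists>r. r \<in> ball (x $ i) d \<and> t $ i = to_circle r"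
      using t(2) unfolding V_def by blast
    then obtain y where y: "\<And>i. y i \<in> ball (x $ i) d" "\<And>i. t $ i = to_circle (y i)"
      by metis
    have "norm ((\<chi> i. y i) - x) \<le> (\<Sum>i\<in>UNIV. \<bar>((\<chi> i. y i) - x) $ i\<bar>)"
      by (rule norm_le_l1_cart)
    also have "\<dots> < (\<Sum>i\<in>(UNIV :: 'k set). d)"
      using y(1) by (intro sum_strict_mono) (auto simp: dist_real_def abs_minus_commute)
    also have "\<dots> = e"
      by (simp add: d_def)
    finally have "dist (\<chi> i. y i) x < e"
      by (simp add: dist_norm)
    moreover have "to_torus (\<chi> i. y i) = t"
      using y(2) by (simp add: to_torus_def vec_eq_iff)
    ultimately show ?thesis
      using t(1) by blast
  qed
  then show ?thesis
    by (auto simp: closure_approachable)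
qed

lemma vimage_to_torus_borel:
  assumes "B \<in> sets borel"
  shows "to_torus -` B \<in> sets borel"
  using measurable_sets_borel[OF borel_measurable_continuous_onI[OF continuous_on_to_torus] assms] .

section \<open>Null sets and measurable sets of the torus\<close>

text \<open>
  The definition only speaks of the part of the preimage inside the unit cube. The preimage is
  invariant under the countably many integer vectors, and their translates of the cube cover the
  space, so it is null as soon as that part is.
\<close>

lemma null_sets_borel_torus_iff:
  fixes N :: "(circle ^ 'k::finite) set"
  shows "N \<in> null_sets (distr (restrict_space lborel unit_cube) borel to_torus) \<longleftrightarrow>
    N \<in> sets borel \<and> negligible (to_torus -` N)"
proof -
  let ?N = "to_torus -` N :: (real ^ 'k) set"
  have cube: "N \<in> null_sets (distr (restrict_space lborel unit_cube) borel to_torus) \<longleftrightarrow>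
      N \<in> sets borel \<and> negligible (?N \<inter> unit_cube)"
  proof (cases "N \<in> sets borel")
    case True
    have "?N \<in> sets borel"
      using True by (rule vimage_to_torus_borel)
    then have b: "?N \<inter> unit_cube \<in> sets lborel"
      by (simp add: unit_cube_borel)
    have "emeasure (distr (restrict_space lborel unit_cube) borel to_torus) N
        = emeasure lborel (?N \<inter> unit_cube)"
      using True b
      by (simp add: emeasure_distr to_torus_measurable space_restrict_space emeasure_restrict_space unit_cube_borel)
    moreover have "negligible (?N \<inter> unit_cube) \<longleftrightarrow> emeasure lborel (?N \<inter> unit_cube) = 0"
      using b null_sets_completion_iff[OF b] by (simp add: negligible_iff_null_sets null_sets_def)
    ultimately show ?thesis
      using True by (simp add: null_sets_def)
  next
    case False
    then show ?thesis by (auto simp: null_sets_def)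
  qed
  have "negligible ?N" if neg: "negligible (?N \<inter> unit_cube)"
  proof (rule negligible_subset)
    let ?v = "\<lambda>n :: int ^ 'k. \<chi> i. real_of_int (n $ i)"
    show "negligible (\<Union>n. (+) (?v n) ` (?N \<inter> unit_cube))"
      using neg by (intro negligible_countable_Union) (auto intro: negligible_translation)
    show "?N \<subseteq> (\<Union>n. (+) (?v n) ` (?N \<inter> unit_cube))"
    proof
      fix x
      assume x: "x \<in> ?N"
      define n :: "int ^ 'k" where "n = (\<chi> i. \<lfloor>x $ i\<rfloor>)"
      have "to_torus (x - ?v n) = to_torus x"
        by (simp add: to_torus_def vec_eq_iff to_circle_eq_iff)
      moreover have "x - ?v n \<in> unit_cube"
        by (simp add: unit_cube_def n_def) linarith
      ultimately have "x - ?v n \<in> ?N \<inter> unit_cube"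
        using x by simp
      moreover have "x = ?v n + (x - ?v n)"
        by simp
      ultimately show "x \<in> (\<Union>n. (+) (?v n) ` (?N \<inter> unit_cube))"
        by blast
    qed
  qed
  then show ?thesis
    using cube negligible_subset[of ?N "?N \<inter> unit_cube"] by blast
qed

lemma null_sets_torus_iff:
  "N \<in> null_sets torus_measure \<longleftrightarrow> (\<exists>N'\<in>sets borel. negligible (to_torus -` N') \<and> N \<subseteq> N')"
  unfolding torus_measure_def null_sets_completion_iff2 Bex_def null_sets_borel_torus_iff by blast

lemma sets_torus_iff:
  "D \<in> sets torus_measure \<longleftrightarrow> (\<exists>B\<in>sets borel. \<exists>N\<in>null_sets torus_measure. D = B \<union> N)"
proof -
  have "D \<in> sets torus_measure" if "B \<in> sets borel" "N \<in> null_sets torus_measure" "D = B \<union> N" for B N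
    using that by (auto simp: torus_measure_def intro!: sets.Un)
  moreover have "\<exists>B\<in>sets borel. \<exists>N\<in>null_sets torus_measure. D = B \<union> N" if D: "D \<in> sets torus_measure"
    using D[unfolded torus_measure_def]
  proof (rule sets_completionE)
    fix B N N'
    assume BN: "D = B \<union> N" "N \<subseteq> N'"
      "N' \<in> null_sets (distr (restrict_space lborel unit_cube) borel to_torus)"
      "B \<in> sets (distr (restrict_space lborel unit_cube) borel to_torus)"
    have "N \<in> null_sets torus_measure"
      using BN(2,3) unfolding torus_measure_def by (rule null_sets_completion_subset[OF _ null_sets_completionI])
    moreover have "B \<in> sets borel"
      using BN(4) by simp
    ultimately show ?thesis
      using BN(1) by blast
  qed
  ultimately show ?thesis by blast
qed

lemma negligible_vimage_to_torus:
  assumes "N \<in> null_sets torus_measure"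
  shows "negligible (to_torus -` N)"
proof -
  obtain N' where "negligible (to_torus -` N')" "N \<subseteq> N'"
    using assms unfolding null_sets_torus_iff by blast
  then show ?thesis
    by (rule negligible_subset[OF _ vimage_mono])
qed

lemma AE_to_torus:
  assumes "AE t in torus_measure. P t"
  shows "AE x in lebesgue. P (to_torus x)"
proof -
  obtain N where N: "\<And>t. t \<in> space torus_measure - N \<Longrightarrow> P t" "N \<in> null_sets torus_measure"
    by (rule AE_E3[OF assms]) (rule that)
  then have "{t. \<not> P t} \<subseteq> N"
    by auto
  then have "negligible (to_torus -` {t. \<not> P t})"
    by (rule negligible_subset[OF negligible_vimage_to_torus[OF N(2)] vimage_mono])
  then show ?thesis
    by (simp add: AE_lebesgue_iff_negligible vimage_def)
qed

lemma vimage_to_torus_measurable: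
  assumes "D \<in> sets torus_measure"
  shows "to_torus -` D \<in> sets lebesgue"
proof -
  obtain B N where BN: "B \<in> sets borel" "N \<in> null_sets torus_measure" "D = B \<union> N"
    using assms unfolding sets_torus_iff by blast
  have "to_torus -` B \<in> sets borel"
    using BN(1) by (rule vimage_to_torus_borel)
  moreover have "to_torus -` N \<in> sets lebesgue"
    using negligible_vimage_to_torus[OF BN(2)] by (simp add: negligible_imp_sets)
  ultimately show ?thesis
    using BN(3) by (auto simp: vimage_Un intro!: sets.Un)
qed

subsection \<open>Rotations\<close>

lemma rotation_1: "rotation \<alpha> 1 t = t + \<alpha>"
  by (simp add: rotation_def)

lemma continuous_on_circle_translation: "continuous_on UNIV (\<lambda>t :: circle. t + c)"
proof -
  obtain r where r: "c = to_circle r"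
    by (metis Quotient3_abs_rep[OF Quotient3_circle])
  have "to_circle -` ((\<lambda>t. t + c) -` U) = (\<lambda>x. x + r) -` (to_circle -` U)" for U
    by (auto simp: r to_circle_add)
  moreover have "open ((\<lambda>x. x + r) -` (to_circle -` U))" if "open U" for U
  proof (rule open_vimage)
    show "open (to_circle -` U)"
      using that by (simp add: open_circle_def)
  qed (intro continuous_intros)
  ultimately show ?thesis
    by (simp add: continuous_on_open_vimage open_circle_def[of "_ -` _"])
qed

lemma rotation_vimage_borel:
  assumes "B \<in> sets borel"
  shows "rotation \<alpha> 1 -` B \<in> sets borel"
proof -
  have "continuous_on UNIV (\<lambda>t. \<chi> i. t $ i + \<alpha> $ i)"
    by (intro continuous_on_vec_lambda continuous_on_compose2[OF continuous_on_circle_translation])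
      (simp_all add: continuous_on_component)
  moreover have "rotation \<alpha> 1 = (\<lambda>t. \<chi> i. t $ i + \<alpha> $ i)"
    by (simp add: fun_eq_iff rotation_1 vec_eq_iff)
  ultimately have "continuous_on UNIV (rotation \<alpha> 1)"
    by simp
  then show ?thesis
    by (intro measurable_sets_borel[OF borel_measurable_continuous_onI assms])
qed

text \<open>
  In Euclidean space the rotation lifts to a translation, which preserves null sets.
\<close>

lemma rotation_vimage_null:
  assumes "N \<in> null_sets torus_measure"
  shows "rotation \<alpha> 1 -` N \<in> null_sets torus_measure"
proof -
  obtain N' where N': "N' \<in> sets borel" "negligible (to_torus -` N')" "N \<subseteq> N'"
    using assms unfolding null_sets_torus_iff by blast
  obtain a where a: "\<alpha> = to_torus a"
    using surj_to_torus by blast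
  have "to_torus -` (rotation \<alpha> 1 -` N') = (+) (- a) ` (to_torus -` N')"
    by (force simp: rotation_1 a to_torus_add[symmetric] image_iff)
  then have "negligible (to_torus -` (rotation \<alpha> 1 -` N'))"
    using negligible_translation[OF N'(2), of "- a"] by simp
  then show ?thesis
    unfolding null_sets_torus_iff using N' rotation_vimage_borel[OF N'(1), of \<alpha>]
    by (intro bexI[of _ "rotation \<alpha> 1 -` N'"]) auto
qed

lemma rotation_vimage_measurable:
  assumes "D \<in> sets torus_measure"
  shows "rotation \<alpha> 1 -` D \<in> sets torus_measure"
proof -
  obtain B N where BN: "B \<in> sets borel" "N \<in> null_sets torus_measure" "D = B \<union> N"
    using assms unfolding sets_torus_iff by blast
  show ?thesis
    unfolding sets_torus_iff BN(3) vimage_Un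
    using rotation_vimage_borel[OF BN(1)] rotation_vimage_null[OF BN(2)] by blast
qed

section \<open>Labelled partitions\<close>

text \<open>
  Having total measure 1 is restated through the null complement, the form in which it is stable
  under rotations and unions.
\<close>

lemma labelled_partitions_iff:
  fixes P :: "bit \<Rightarrow> (circle ^ 'k::finite) set"
  shows "P \<in> labelled_partitions \<longleftrightarrow>
    (\<forall>a. P a \<in> sets torus_measure) \<and> P 0 \<inter> P 1 = {} \<and> - (P 0 \<union> P 1) \<in> null_sets torus_measure"
proof -
  interpret finite_measure "torus_measure :: (circle ^ 'k) measure"
    by standard (simp add: emeasure_torus_UNIV)
  have "measure torus_measure (P 0 \<union> P 1) = 1 \<longleftrightarrow> - (P 0 \<union> P 1) \<in> null_sets torus_measure"
    if "\<forall>a. P a \<in> sets torus_measure"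
  proof -
    have U: "P 0 \<union> P 1 \<in> sets torus_measure"
      using that by (intro sets.Un) blast+
    have "measure torus_measure (- (P 0 \<union> P 1)) = 1 - measure torus_measure (P 0 \<union> P 1)"
      using finite_measure_compl[OF U] emeasure_torus_UNIV[where 'k = 'k]
      by (simp add: Compl_eq_Diff_UNIV measure_def)
    moreover have "- (P 0 \<union> P 1) \<in> sets torus_measure"
      using sets.compl_sets[OF U] by (simp add: Compl_eq_Diff_UNIV)
    ultimately show ?thesis
      by (simp add: null_sets_def emeasure_eq_measure)
  qed
  then show ?thesis
    unfolding labelled_partitions_def by blast
qed

lemma labelled_partition_AE:
  assumes "P \<in> labelled_partitions"
  shows "AE t in torus_measure. t \<in> P 0 \<longleftrightarrow> t \<notin> P 1"
proof (rule AE_I')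
  show "- (P 0 \<union> P 1) \<in> null_sets torus_measure"
    using assms by (simp add: labelled_partitions_iff)
  show "{t \<in> space torus_measure. \<not> (t \<in> P 0 \<longleftrightarrow> t \<notin> P 1)} \<subseteq> - (P 0 \<union> P 1)"
    using assms by (auto simp: labelled_partitions_iff)
qed

lemma ae_equal_AE:
  assumes "(P, Q) \<in> ae_equal"
  shows "AE t in torus_measure. t \<in> P a \<longleftrightarrow> t \<in> Q a"
proof (rule AE_I')
  show "(P a - Q a) \<union> (Q a - P a) \<in> null_sets torus_measure"
    using assms by (simp add: ae_equal_def)
qed auto

lemma ex_bit_iff: "(\<exists>c :: bit. Q c) \<longleftrightarrow> Q 0 \<or> Q 1"
  by (metis bit.exhaust)

lemma mem_induced_ledrappier:
  "t \<in> induced ledrappier \<alpha> P a \<longleftrightarrow> (\<exists>c0 c1. c0 + c1 = a \<and> t \<in> P c0 \<and> t + \<alpha> \<in> P c1)"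
  unfolding induced_ledrappier by (auto simp: rotation_1)

lemma mem_induced_0:
  "t \<in> induced ledrappier \<alpha> P 0 \<longleftrightarrow> t \<in> P 0 \<and> t + \<alpha> \<in> P 0 \<or> t \<in> P 1 \<and> t + \<alpha> \<in> P 1"
  by (simp add: mem_induced_ledrappier ex_bit_iff)

lemma mem_induced_1:
  "t \<in> induced ledrappier \<alpha> P 1 \<longleftrightarrow> t \<in> P 0 \<and> t + \<alpha> \<in> P 1 \<or> t \<in> P 1 \<and> t + \<alpha> \<in> P 0"
  by (simp add: mem_induced_ledrappier ex_bit_iff)

text \<open>
  A point gets no label from the image partition only if it or its rotation by \<open>\<alpha>\<close> has no label in
  \<open>P\<close>. Both exceptional sets are null, the second because rotations preserve null sets.
\<close>

lemma induced_labelled: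
  assumes "P \<in> labelled_partitions"
  shows "induced ledrappier \<alpha> P \<in> labelled_partitions"
  unfolding labelled_partitions_iff
proof (intro conjI allI)
  have P: "P 0 \<inter> P 1 = {}" "- (P 0 \<union> P 1) \<in> null_sets torus_measure" "\<And>a. P a \<in> sets torus_measure"
    using assms by (auto simp: labelled_partitions_iff)
  show meas: "induced ledrappier \<alpha> P a \<in> sets torus_measure" for a
    unfolding induced_ledrappier
  proof (rule sets.finite_UN)
    show "finite {(c0, c1). c0 + c1 = a}"
      by (rule finite_subset[of _ "{0, 1} \<times> {0, 1}"]) auto
  qed (auto intro!: sets.Int P rotation_vimage_measurable)
  show "induced ledrappier \<alpha> P 0 \<inter> induced ledrappier \<alpha> P 1 = {}"
    using P(1) by (auto simp: mem_induced_0 mem_induced_1)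
  show "- (induced ledrappier \<alpha> P 0 \<union> induced ledrappier \<alpha> P 1) \<in> null_sets torus_measure"
  proof (rule null_sets_subset)
    show "- (P 0 \<union> P 1) \<union> rotation \<alpha> 1 -` (- (P 0 \<union> P 1)) \<in> null_sets torus_measure"
      using P(2) by (intro null_sets.Un rotation_vimage_null)
    show "- (induced ledrappier \<alpha> P 0 \<union> induced ledrappier \<alpha> P 1) \<in> sets torus_measure"
      using sets.compl_sets[OF sets.Un[OF meas[of 0] meas[of 1]]] by (simp add: Compl_eq_Diff_UNIV)
    show "- (induced ledrappier \<alpha> P 0 \<union> induced ledrappier \<alpha> P 1)
        \<subseteq> - (P 0 \<union> P 1) \<union> rotation \<alpha> 1 -` (- (P 0 \<union> P 1))"
      by (auto simp: mem_induced_0 mem_induced_1 rotation_1)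
  qed
qed

lemma swap_labels_labelled:
  "P \<in> labelled_partitions \<Longrightarrow> swap_labels P \<in> labelled_partitions"
  by (simp add: labelled_partitions_iff swap_labels_def Un_commute Int_commute)

lemma partition_space_labelled:
  "\<R> \<in> partition_space \<Longrightarrow> R \<in> \<R> \<Longrightarrow> R \<in> labelled_partitions"
  unfolding partition_space_def using in_quotient_imp_subset[OF equiv_ae_equal] by blast

lemma partition_space_nonempty: "\<R> \<in> partition_space \<Longrightarrow> \<exists>R. R \<in> \<R>"
  unfolding partition_space_def using in_quotient_imp_non_empty[OF equiv_ae_equal] by blast

section \<open>Sets flipped by a rotation\<close>

text \<open>
  Induction on \<open>z\<close> in both directions. Each step moves the almost everywhere relation for
  \<open>\<alpha>\<close> along a translation of Euclidean space that lifts a multiple of \<open>\<alpha>\<close>.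
\<close>

lemma torus_flip_multiples:
  fixes \<alpha> :: "circle ^ 'k::finite"
  assumes flip: "AE x in lebesgue. to_torus x + \<alpha> \<in> D \<longleftrightarrow> to_torus x \<notin> D"
  shows "AE x in lebesgue. to_torus x + int_mult z \<alpha> \<in> D \<longleftrightarrow> (to_torus x \<in> D \<longleftrightarrow> even z)"
proof (induction z rule: int_induct[of _ 0])
  case base
  show ?case by (simp add: int_mult_def)
next
  case (step1 z)
  obtain s :: "real ^ 'k" where s: "int_mult z \<alpha> = to_torus s"
    using surj_to_torus by blast
  show ?case
    using step1.IH AE_lebesgue_translate[OF flip, of s]
    by eventually_elim (auto simp: int_mult_Suc s to_torus_add add.assoc)
next
  case (step2 z)
  obtain s :: "real ^ 'k" where s: "int_mult (z - 1) \<alpha> = to_torus s"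
    using surj_to_torus by blast
  have z: "int_mult z \<alpha> = to_torus s + \<alpha>"
    using int_mult_Suc[of "z - 1" \<alpha>] by (simp add: s)
  show ?case
    using step2.IH AE_lebesgue_translate[OF flip, of s]
    by eventually_elim (auto simp: s z to_torus_add add.assoc)
qed

lemma no_flip_of_dense_orbit:
  fixes \<alpha> :: "circle ^ 'k::finite"
  assumes dense: "closure (range (\<lambda>z :: int. int_mult z \<alpha>)) = UNIV"
    and D: "D \<in> sets torus_measure"
  shows "\<not> (AE x in lebesgue. to_torus x + \<alpha> \<in> D \<longleftrightarrow> to_torus x \<notin> D)"
proof
  assume flip: "AE x in lebesgue. to_torus x + \<alpha> \<in> D \<longleftrightarrow> to_torus x \<notin> D"
  obtain a where a: "\<alpha> = to_torus a"
    using surj_to_torus by blast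
  have "\<not> (AE x in lebesgue. x + a \<in> to_torus -` D \<longleftrightarrow> x \<notin> to_torus -` D)"
  proof (rule no_flip_of_dense)
    show "to_torus -` D \<in> sets lebesgue"
      using D by (rule vimage_to_torus_measurable)
    show "closure (to_torus -` range (\<lambda>z :: int. int_mult z \<alpha>)) = UNIV"
      using dense by (rule dense_vimage_to_torus)
    show "\<exists>e. AE x in lebesgue. x + l \<in> to_torus -` D \<longleftrightarrow> (x \<in> to_torus -` D \<longleftrightarrow> e)"
      if l: "l \<in> to_torus -` range (\<lambda>z :: int. int_mult z \<alpha>)" for l
    proof -
      obtain z :: int where "to_torus l = int_mult z \<alpha>"
        using l by auto
      then show ?thesis
        using torus_flip_multiples[OF flip, of z] by (intro exI[of _ "even z"]) (simp add: to_torus_add)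
    qed
  qed
  then show False
    using flip by (simp add: a to_torus_add)
qed

text \<open>
  Representatives \<open>R\<close> and \<open>S\<close> of the two preimage classes give the flipped set: the symmetric
  difference of \<open>R 1\<close> and \<open>S 1\<close> consists, up to null sets, of the points that \<open>R\<close> and \<open>S\<close>
  label differently.
\<close>

theorem proposition8p1:
  fixes \<alpha> :: "circle ^ 'k::finite"
    and \<P> :: "(bit \<Rightarrow> (circle ^ 'k) set) set"
  assumes "inj (\<lambda>z :: int. int_mult z \<alpha>)"
    and "closure (range (\<lambda>z :: int. int_mult z \<alpha>)) = UNIV"
    and "\<P> \<in> induced_class ledrappier \<alpha> ` partition_space"
  shows "swap_class \<P> \<notin> induced_class ledrappier \<alpha> ` partition_space"
proof
  assume "swap_class \<P> \<in> induced_class ledrappier \<alpha> ` partition_space"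
  then obtain \<S> where \<S>: "\<S> \<in> partition_space" "swap_class \<P> = induced_class ledrappier \<alpha> \<S>"
    by blast
  obtain \<R> where \<R>: "\<R> \<in> partition_space" "\<P> = induced_class ledrappier \<alpha> \<R>"
    using assms(3) by blast
  obtain R where "R \<in> \<R>"
    using partition_space_nonempty[OF \<R>(1)] by blast
  then have R: "R \<in> labelled_partitions"
    using \<R>(1) partition_space_labelled by blast
  define P where "P = induced ledrappier \<alpha> R"
  have P: "P \<in> labelled_partitions"
    using R by (simp add: P_def induced_labelled)
  then have "P \<in> \<P>"
    unfolding \<R>(2) induced_class_def P_def using \<open>R \<in> \<R>\<close> equiv_class_self[OF equiv_ae_equal] by blast
  then have "swap_labels P \<in> swap_class \<P>"
    unfolding swap_class_def
    using swap_labels_labelled[OF P] equiv_class_self[OF equiv_ae_equal] by blast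
  then obtain S where "S \<in> \<S>" and SP: "(induced ledrappier \<alpha> S, swap_labels P) \<in> ae_equal"
    unfolding \<S>(2) induced_class_def by blast
  then have S: "S \<in> labelled_partitions"
    using \<S>(1) partition_space_labelled by blast
  define D where "D = (R 1 - S 1) \<union> (S 1 - R 1)"
  have D: "D \<in> sets torus_measure"
    using R S by (auto simp: D_def labelled_partitions_def)
  obtain a where a: "\<alpha> = to_torus a"
    using surj_to_torus by blast
  note R_AE = AE_to_torus[OF labelled_partition_AE[OF R]]
    and S_AE = AE_to_torus[OF labelled_partition_AE[OF S]]
  have "AE x in lebesgue. to_torus x + \<alpha> \<in> D \<longleftrightarrow> to_torus x \<notin> D"
    using R_AE S_AE AE_lebesgue_translate[OF R_AE, of a] AE_lebesgue_translate[OF S_AE, of a]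
      AE_to_torus[OF ae_equal_AE[OF SP, of 1]]
  proof eventually_elim
    case (elim x)
    then show ?case
      unfolding D_def swap_labels_def P_def
      by (simp add: mem_induced_0 mem_induced_1 to_torus_add a[symmetric]) blast
  qed
  then show False
    using no_flip_of_dense_orbit[OF assms(2) D] by blast
qed

end
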